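(* Let $n\ge1$ and let $X_1,\dots,X_n$ be real-valued random variables on a common probability space such that $X_i$ is $(\sigma_i,\rho_i)$-subgaussian for each $i=1,\dots,n$, where $\sigma_i>0$ and $\rho_i\ge1$. Then: (i) $X:=\sum_{i=1}^n X_i$ is $(\sigma,\rho)$-subgaussian with $$\sigma=\sum_{i=1}^n\sigma_i,\qquad \ln\rho=\frac{\sum_{i=1}^n\sigma_i\ln\rho_i}{\sum_{i=1}^n\sigma_i}.$$ (ii) If $X_1,\dots,X_n$ are independent, then $X:=\sum_{i=1}^nX_i$ is $(\sigma,\rho)$-subgaussian with $$\sigma=\sqrt{\sum_{i=1}^n\sigma_i^2},\qquad \rho=\prod_{i=1}^n\rho_i.$$ (iii) $X:=\max_{i=1,\dots,n}X_i$ is $(\sigma,\rho)$-subgaussian with $$\sigma=\max_{1\le i\le n}\sigma_i,\qquad \rho=\sum_{i=1}^n\rho_i.$$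
   Context: A real random variable $X$ is called $(\sigma,\rho)$-subgaussian, for constants $\sigma>0$ and $\rho\ge1$, if $\mathbb{E}[\exp(\lambda X)]\le\rho\exp(\frac12\sigma^2\lambda^2)$ for all $\lambda\in\mathbb{R}$ (in particular these expectations are finite). *)

theory Defs
  imports "HOL-Probability.Probability"
begin

text \<open>
  Finiteness of the exponential moments is required explicitly, because the Bochner integral
  of a non-integrable function is \<open>0\<close> and would satisfy the bound vacuously.
\<close>

definition subgaussian :: "'a measure \<Rightarrow> real \<Rightarrow> real \<Rightarrow> ('a \<Rightarrow> real) \<Rightarrow> bool" where
  "subgaussian M \<sigma> \<rho> X \<longleftrightarrow>
     \<sigma> > 0 \<and> \<rho> \<ge> 1 \<and> X \<in> borel_measurable M \<and>
     (\<forall>t::real. integrable M (\<lambda>\<omega>. exp (t * X \<omega>)) \<and>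
        (\<integral>\<omega>. exp (t * X \<omega>) \<partial>M) \<le> \<rho> * exp (1 / 2 * \<sigma>\<^sup>2 * t\<^sup>2))"

end

theory Submission
  imports Defs
begin

text \<open>
  The three bounds rest on three pointwise facts about the exponential, integrated afterwards.

  For an arbitrary sum the bound is Hoelder's inequality with the exponents \<open>1 / w i\<close>, where
  \<open>w i = \<sigma> i / S\<close> and \<open>S = (\<Sum>i\<in>I. \<sigma> i)\<close>, in the form given by its usual
  proof: Jensen's inequality for \<open>exp\<close>, applied to the exponents \<open>t * X i / w i\<close> after subtracting
  from each the logarithm \<open>c i\<close> of the bound on its exponential moment. Every normalised exponential has expectation at most \<open>1\<close>, hence so has their
  weighted average. The weights proportional to \<open>\<sigma> i\<close> are those for which the Gaussian part of
  \<open>c i\<close> is \<open>S\<^sup>2 * t\<^sup>2 / 2\<close> for every \<open>i\<close>, which is the exponent to be reached.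

  For an independent sum, the exponential turns the sum into a product and independence
  makes the expectation multiplicative. For a maximum, \<open>exp (t * Max)\<close> is one
  of the terms \<open>exp (t * X i)\<close>, so it is bounded by their sum, whatever the sign of \<open>t\<close>.
\<close>

lemma subgaussianD:
  assumes "subgaussian M \<sigma> \<rho> X"
  shows "\<sigma> > 0" "\<rho> \<ge> 1" "X \<in> borel_measurable M"
    and "integrable M (\<lambda>\<omega>. exp (t * X \<omega>))"
    and "(\<integral>\<omega>. exp (t * X \<omega>) \<partial>M) \<le> \<rho> * exp (1 / 2 * \<sigma>\<^sup>2 * t\<^sup>2)"
  using assms unfolding subgaussian_def by auto

text \<open>
  The exponential of a sum or of a maximum is not known in advance to be integrable; the majorant
  \<open>g t\<close>, built from the integrable \<open>exp (s * X i \<omega>)\<close>, supplies that together with the bound.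
\<close>

lemma subgaussianI_majorant:
  assumes "\<sigma> > 0" "\<rho> \<ge> 1" and meas: "X \<in> borel_measurable M"
    and int: "\<And>t. integrable M (g t)"
    and le: "\<And>t \<omega>. exp (t * X \<omega>) \<le> g t \<omega>"
    and bound: "\<And>t. (\<integral>\<omega>. g t \<omega> \<partial>M) \<le> \<rho> * exp (1 / 2 * \<sigma>\<^sup>2 * t\<^sup>2)"
  shows "subgaussian M \<sigma> \<rho> X"
  unfolding subgaussian_def
proof (intro conjI allI)
  fix t :: real
  show "integrable M (\<lambda>\<omega>. exp (t * X \<omega>))"
  proof (rule Bochner_Integration.integrable_bound[OF int[of t]])
    show "(\<lambda>\<omega>. exp (t * X \<omega>)) \<in> borel_measurable M"
      using meas by measurable
    show "AE \<omega> in M. norm (exp (t * X \<omega>)) \<le> norm (g t \<omega>)"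
      using le[of t] by (auto intro!: AE_I2 order_trans[OF _ abs_ge_self])
  qed
  then have "(\<integral>\<omega>. exp (t * X \<omega>) \<partial>M) \<le> (\<integral>\<omega>. g t \<omega> \<partial>M)"
    using int le by (intro integral_mono) auto
  then show "(\<integral>\<omega>. exp (t * X \<omega>) \<partial>M) \<le> \<rho> * exp (1 / 2 * \<sigma>\<^sup>2 * t\<^sup>2)"
    using bound[of t] by linarith
qed (use assms in auto)

text \<open>
  Jensen's inequality for \<open>exp\<close> at the points \<open>x i / w i - c i\<close>, multiplied through by
  \<open>exp (\<Sum>i\<in>I. w i * c i)\<close>. The free shifts \<open>c i\<close> do the work of the normalisation
  in the proof of Hoelder's inequality.
\<close>

lemma exp_sum_le_weighted_sum_exp:
  fixes w x c :: "'i \<Rightarrow> real"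
  assumes I: "finite I" "I \<noteq> {}" and w: "\<And>i. i \<in> I \<Longrightarrow> w i > 0" "(\<Sum>i\<in>I. w i) = 1"
  shows "exp (\<Sum>i\<in>I. x i) \<le>
    exp (\<Sum>i\<in>I. w i * c i) * (\<Sum>i\<in>I. w i * (exp (x i / w i) * exp (- c i)))"
proof -
  have "(\<Sum>i\<in>I. x i) = (\<Sum>i\<in>I. w i * c i) + (\<Sum>i\<in>I. w i *\<^sub>R (x i / w i - c i))"
    using w(1) by (simp flip: sum.distrib)
      (intro sum.cong; force simp: field_simps)
  moreover have "exp (\<Sum>i\<in>I. w i *\<^sub>R (x i / w i - c i))
      \<le> (\<Sum>i\<in>I. w i * exp (x i / w i - c i))"
    using I w by (intro convex_on_sum[OF _ _ exp_convex]) (auto simp: less_imp_le)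
  ultimately show ?thesis
    by (simp add: exp_add exp_diff exp_minus divide_inverse)
qed

text \<open>
  The constant is the exponential of the \<open>\<sigma>\<close>-weighted mean of the \<open>ln (\<rho> i)\<close>: by the choice of the
  weights, the shift \<open>c t i\<close> has the same Gaussian part for every \<open>i\<close>, and averaging the shifts
  leaves it unchanged.
\<close>

lemma subgaussian_sum:
  fixes \<sigma> \<rho> :: "'i \<Rightarrow> real"
  assumes I: "finite I" "I \<noteq> {}" and sub: "\<And>i. i \<in> I \<Longrightarrow> subgaussian M (\<sigma> i) (\<rho> i) (X i)"
  shows "subgaussian M (\<Sum>i\<in>I. \<sigma> i)
    (exp ((\<Sum>i\<in>I. \<sigma> i * ln (\<rho> i)) / (\<Sum>i\<in>I. \<sigma> i))) (\<lambda>\<omega>. \<Sum>i\<in>I. X i \<omega>)"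
proof -
  define S where "S = (\<Sum>i\<in>I. \<sigma> i)"
  define w where "w i = \<sigma> i / S" for i
  define c where "c t i = ln (\<rho> i) + 1 / 2 * S\<^sup>2 * t\<^sup>2" for t i
  define g where "g t \<omega> = exp (\<Sum>i\<in>I. w i * c t i) *
      (\<Sum>i\<in>I. w i * (exp ((t / w i) * X i \<omega>) * exp (- c t i)))" for t \<omega>
  note D = subgaussianD[OF sub]
  have S: "S > 0"
    unfolding S_def using I D(1) by (intro sum_pos) auto
  have w_pos: "w i > 0" if "i \<in> I" for i
    using S D(1)[OF that] by (simp add: w_def)
  have w_sum: "(\<Sum>i\<in>I. w i) = 1"
    using S by (simp add: w_def S_def flip: sum_divide_distrib)
  have wc: "(\<Sum>i\<in>I. w i * c t i) = (\<Sum>i\<in>I. \<sigma> i * ln (\<rho> i)) / S + 1 / 2 * S\<^sup>2 * t\<^sup>2" for t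
  proof -
    have "(\<Sum>i\<in>I. w i * c t i) = (\<Sum>i\<in>I. w i * ln (\<rho> i)) + (\<Sum>i\<in>I. w i) * (1 / 2 * S\<^sup>2 * t\<^sup>2)"
      by (simp add: c_def distrib_left sum.distrib sum_distrib_right)
    then show ?thesis
      by (simp add: w_sum) (simp add: w_def sum_divide_distrib)
  qed
  have normalised: "(\<integral>\<omega>. exp ((t / w i) * X i \<omega>) \<partial>M) * exp (- c t i) \<le> 1" if i: "i \<in> I" for t i
  proof -
    have "\<sigma> i * (t / w i) = S * t"
      using S D(1)[OF i] by (simp add: w_def)
    then have "(\<sigma> i)\<^sup>2 * (t / w i)\<^sup>2 = S\<^sup>2 * t\<^sup>2"
      by (metis power_mult_distrib)
    then have "\<rho> i * exp (1 / 2 * (\<sigma> i)\<^sup>2 * (t / w i)\<^sup>2) = exp (c t i)"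
      using D(2)[OF i] by (simp add: c_def exp_add mult.assoc)
    then have "(\<integral>\<omega>. exp ((t / w i) * X i \<omega>) \<partial>M) \<le> exp (c t i)"
      using D(5)[OF i, of "t / w i"] by simp
    then show ?thesis
      by (simp add: exp_minus field_simps)
  qed
  show ?thesis
    unfolding S_def[symmetric]
  proof (rule subgaussianI_majorant[where g = g])
    show "exp ((\<Sum>i\<in>I. \<sigma> i * ln (\<rho> i)) / S) \<ge> 1"
      using S D(1,2) by (auto intro!: divide_nonneg_pos sum_nonneg mult_nonneg_nonneg simp: less_imp_le)
    show "(\<lambda>\<omega>. \<Sum>i\<in>I. X i \<omega>) \<in> borel_measurable M"
      using D(3) by (rule borel_measurable_sum)
  next
    fix t
    show "integrable M (g t)"
      unfolding g_def
      by (intro integrable_mult_right Bochner_Integration.integrable_sum integrable_mult_left D(4))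
  next
    fix t \<omega>
    show "exp (t * (\<Sum>i\<in>I. X i \<omega>)) \<le> g t \<omega>"
      using exp_sum_le_weighted_sum_exp[OF I w_pos w_sum, of "\<lambda>i. t * X i \<omega>" "c t"]
      by (simp add: g_def sum_distrib_left)
  next
    fix t
    have "(\<integral>\<omega>. g t \<omega> \<partial>M) = exp (\<Sum>i\<in>I. w i * c t i) *
        (\<Sum>i\<in>I. w i * ((\<integral>\<omega>. exp ((t / w i) * X i \<omega>) \<partial>M) * exp (- c t i)))"
      unfolding g_def
      by (subst integral_mult_right_zero, subst Bochner_Integration.integral_sum)
        (auto simp del: times_divide_eq_left
          intro!: integrable_mult_right integrable_mult_left D(4))
    also have "\<dots> \<le> exp (\<Sum>i\<in>I. w i * c t i) * (\<Sum>i\<in>I. w i * 1)"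
      using w_pos normalised by (intro mult_left_mono sum_mono) (auto simp: less_imp_le)
    also have "\<dots> = exp ((\<Sum>i\<in>I. \<sigma> i * ln (\<rho> i)) / S) * exp (1 / 2 * S\<^sup>2 * t\<^sup>2)"
      by (simp only: wc w_sum mult_1_right exp_add)
    finally show "(\<integral>\<omega>. g t \<omega> \<partial>M) \<le> \<dots>" .
  qed (use S in auto)
qed

text \<open>
  Independence makes the exponential moments multiply, and so do their bounds: the factors
  \<open>\<rho> i\<close> multiply, while the \<open>(\<sigma> i)\<^sup>2\<close> add because they stand in exponents.
\<close>

lemma (in prob_space) subgaussian_sum_indep:
  fixes \<sigma> \<rho> :: "'i \<Rightarrow> real"
  assumes I: "finite I" "I \<noteq> {}" and sub: "\<And>i. i \<in> I \<Longrightarrow> subgaussian M (\<sigma> i) (\<rho> i) (X i)"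
    and indep: "indep_vars (\<lambda>_. borel) X I"
  shows "subgaussian M (sqrt (\<Sum>i\<in>I. (\<sigma> i)\<^sup>2)) (\<Prod>i\<in>I. \<rho> i) (\<lambda>\<omega>. \<Sum>i\<in>I. X i \<omega>)"
proof -
  note D = subgaussianD[OF sub]
  have V: "(\<Sum>i\<in>I. (\<sigma> i)\<^sup>2) > 0"
    using I D(1) by (intro sum_pos) force+
  have indep_exp: "indep_vars (\<lambda>_. borel) (\<lambda>i \<omega>. exp (t * X i \<omega>)) I" for t
    by (rule indep_vars_compose2[OF indep]) auto
  show ?thesis
  proof (rule subgaussianI_majorant[where g = "\<lambda>t \<omega>. \<Prod>i\<in>I. exp (t * X i \<omega>)"])
    show "(\<Prod>i\<in>I. \<rho> i) \<ge> 1"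
      using D(2) by (rule prod_ge_1)
    show "(\<lambda>\<omega>. \<Sum>i\<in>I. X i \<omega>) \<in> borel_measurable M"
      using D(3) by (rule borel_measurable_sum)
  next
    fix t
    show "integrable M (\<lambda>\<omega>. \<Prod>i\<in>I. exp (t * X i \<omega>))"
      using I(1) indep_exp D(4) by (rule indep_vars_integrable)
  next
    fix t \<omega>
    show "exp (t * (\<Sum>i\<in>I. X i \<omega>)) \<le> (\<Prod>i\<in>I. exp (t * X i \<omega>))"
      using I(1) by (simp add: exp_sum sum_distrib_left)
  next
    fix t
    have "(\<integral>\<omega>. (\<Prod>i\<in>I. exp (t * X i \<omega>)) \<partial>M) = (\<Prod>i\<in>I. \<integral>\<omega>. exp (t * X i \<omega>) \<partial>M)"
      using I(1) indep_exp D(4) by (rule indep_vars_lebesgue_integral)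
    also have "\<dots> \<le> (\<Prod>i\<in>I. \<rho> i * exp (1 / 2 * (\<sigma> i)\<^sup>2 * t\<^sup>2))"
      using D(5) by (intro prod_mono) auto
    also have "\<dots> = (\<Prod>i\<in>I. \<rho> i) * exp (1 / 2 * (sqrt (\<Sum>i\<in>I. (\<sigma> i)\<^sup>2))\<^sup>2 * t\<^sup>2)"
      using I(1) V by (simp add: prod.distrib sum_distrib_left sum_distrib_right sum_divide_distrib flip: exp_sum)
    finally show "(\<integral>\<omega>. (\<Prod>i\<in>I. exp (t * X i \<omega>)) \<partial>M) \<le> \<dots>" .
  qed (use V in auto)
qed

text \<open>
  The sum of all exponentials dominates that of the maximum, and enlarging every \<open>\<sigma> i\<close> to
  the largest one gives the bounds on the summands a common Gaussian factor.
\<close>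

lemma subgaussian_Max:
  fixes \<sigma> \<rho> :: "'i \<Rightarrow> real"
  assumes I: "finite I" "I \<noteq> {}" and sub: "\<And>i. i \<in> I \<Longrightarrow> subgaussian M (\<sigma> i) (\<rho> i) (X i)"
  shows "subgaussian M (MAX i\<in>I. \<sigma> i) (\<Sum>i\<in>I. \<rho> i) (\<lambda>\<omega>. MAX i\<in>I. X i \<omega>)"
proof (rule subgaussianI_majorant[where g = "\<lambda>t \<omega>. \<Sum>i\<in>I. exp (t * X i \<omega>)"])
  note D = subgaussianD[OF sub]
  obtain k where k: "k \<in> I"
    using I(2) by blast
  show "(MAX i\<in>I. \<sigma> i) > 0"
    using I k D(1) by (auto simp: Max_gr_iff)
  have "\<rho> k \<le> (\<Sum>i\<in>I. \<rho> i)"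
    using I(1) k D(2) by (intro member_le_sum) force+
  then show "(\<Sum>i\<in>I. \<rho> i) \<ge> 1"
    using D(2)[OF k] by linarith
  show "(\<lambda>\<omega>. MAX i\<in>I. X i \<omega>) \<in> borel_measurable M"
    using I(1) D(3) by (rule borel_measurable_Max)
next
  fix t
  show "integrable M (\<lambda>\<omega>. \<Sum>i\<in>I. exp (t * X i \<omega>))"
    using subgaussianD(4)[OF sub] by (rule Bochner_Integration.integrable_sum)
next
  fix t \<omega>
  have "(MAX i\<in>I. X i \<omega>) \<in> (\<lambda>i. X i \<omega>) ` I"
    using I by (intro Max_in) auto
  then obtain j where "j \<in> I" "(MAX i\<in>I. X i \<omega>) = X j \<omega>"
    by auto
  then show "exp (t * (MAX i\<in>I. X i \<omega>)) \<le> (\<Sum>i\<in>I. exp (t * X i \<omega>))"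
    using I(1) member_le_sum[of j I "\<lambda>i. exp (t * X i \<omega>)"] by simp
next
  fix t
  note D = subgaussianD[OF sub]
  have "(\<integral>\<omega>. (\<Sum>i\<in>I. exp (t * X i \<omega>)) \<partial>M) = (\<Sum>i\<in>I. \<integral>\<omega>. exp (t * X i \<omega>) \<partial>M)"
    using D(4) by (rule Bochner_Integration.integral_sum)
  also have "\<dots> \<le> (\<Sum>i\<in>I. \<rho> i * exp (1 / 2 * (MAX i\<in>I. \<sigma> i)\<^sup>2 * t\<^sup>2))"
  proof (rule sum_mono)
    fix i assume i: "i \<in> I"
    have "(\<sigma> i)\<^sup>2 \<le> (MAX i\<in>I. \<sigma> i)\<^sup>2"
      using I(1) i D(1)[OF i] by (intro power_mono) auto
    then have "\<rho> i * exp (1 / 2 * (\<sigma> i)\<^sup>2 * t\<^sup>2) \<le> \<rho> i * exp (1 / 2 * (MAX i\<in>I. \<sigma> i)\<^sup>2 * t\<^sup>2)"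
      using D(2)[OF i] by (simp add: mult_right_mono)
    then show "(\<integral>\<omega>. exp (t * X i \<omega>) \<partial>M) \<le> \<rho> i * exp (1 / 2 * (MAX i\<in>I. \<sigma> i)\<^sup>2 * t\<^sup>2)"
      using D(5)[OF i, of t] by linarith
  qed
  also have "\<dots> = (\<Sum>i\<in>I. \<rho> i) * exp (1 / 2 * (MAX i\<in>I. \<sigma> i)\<^sup>2 * t\<^sup>2)"
    by (rule sum_distrib_right[symmetric])
  finally show "(\<integral>\<omega>. (\<Sum>i\<in>I. exp (t * X i \<omega>)) \<partial>M) \<le> \<dots>" .
qed


theorem theorem8:
  fixes M :: "'a measure" and n :: nat
    and X :: "nat \<Rightarrow> 'a \<Rightarrow> real" and \<sigma> \<rho> :: "nat \<Rightarrow> real"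
  assumes "prob_space M"
    and "n \<ge> 1"
    and "\<And>i. i \<in> {1..n} \<Longrightarrow> \<sigma> i > 0"
    and "\<And>i. i \<in> {1..n} \<Longrightarrow> \<rho> i \<ge> 1"
    and "\<And>i. i \<in> {1..n} \<Longrightarrow> subgaussian M (\<sigma> i) (\<rho> i) (X i)"
  shows "(\<exists>r. ln r = (\<Sum>i=1..n. \<sigma> i * ln (\<rho> i)) / (\<Sum>i=1..n. \<sigma> i) \<and>
            subgaussian M (\<Sum>i=1..n. \<sigma> i) r (\<lambda>\<omega>. \<Sum>i=1..n. X i \<omega>))
       \<and> (prob_space.indep_vars M (\<lambda>_. borel) X {1..n} \<longrightarrow>
            subgaussian M (sqrt (\<Sum>i=1..n. (\<sigma> i)\<^sup>2)) (\<Prod>i=1..n. \<rho> i) (\<lambda>\<omega>. \<Sum>i=1..n. X i \<omega>))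
       \<and> subgaussian M (MAX i\<in>{1..n}. \<sigma> i) (\<Sum>i=1..n. \<rho> i) (\<lambda>\<omega>. MAX i\<in>{1..n}. X i \<omega>)"
proof -
  interpret prob_space M by fact
  have I: "finite {1..n}" "{1..n} \<noteq> {}"
    using \<open>n \<ge> 1\<close> by auto
  show ?thesis
    using subgaussian_sum[OF I assms(5)] subgaussian_sum_indep[OF I assms(5)]
      subgaussian_Max[OF I assms(5)]
    by (intro conjI impI exI[of _ "exp ((\<Sum>i=1..n. \<sigma> i * ln (\<rho> i)) / (\<Sum>i=1..n. \<sigma> i))"]) simp_all
qed

end
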